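(* Let $x_1,\dots,x_m$ be algebraically independent variables, let $n_1,\dots,n_m$ be positive integers and $n=\mathrm{lcm}(n_1,\dots,n_m)$. Let $\Bbbk$ be a field and let $e(\Bbbk)=1$ if $\mathrm{char}\,\Bbbk=0$ and $e(\Bbbk)=\mathrm{char}\,\Bbbk$ otherwise. If $\gcd(n,e(\Bbbk))=1$, then the polynomial $$q(\{n_i\},\{x_j\};z)=\chi\bigl(C_{1}\boxplus\dots\boxplus C_{m};\,z\bigr)$$ in the variables $z,x_1,\dots,x_m$, where $C_j$ is the Frobenius companion matrix of the polynomial $t^{n_j}-x_j$, is irreducible over $\Bbbk$.
   Context: The Frobenius companion matrix of $t^{k}-a$ is the $k\times k$ matrix with $1$'s on the subdiagonal, top-right entry $a$ and all other entries $0$ (for $k=1$ it is the $1\times1$ matrix $(a)$). For square matrices $A$ of order $p$ and $B$ of order $q$, the Kronecker sum is $A\boxplus B=A\otimes I_q+I_p\otimes B$ (an associative operation). $\chi(M;z)=\det(zI-M)$. Here the matrices have entries in $\Bbbk[x_1,\dots,x_m]$. *)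

theory Defs
  imports
    "Jordan_Normal_Form.Char_Poly"
    "HOL-Library.Poly_Mapping"
begin

text \<open>
  Polynomials with coefficients in \<open>'a\<close> in variables indexed by \<open>'v\<close>. A monomial is a finitely
  supported exponent function, and the multiplication of \<open>\<Rightarrow>\<^sub>0\<close> is convolution, so for a finite type
  \<open>'v\<close> with \<open>m\<close> elements this is the polynomial ring in exactly \<open>m\<close> variables.
\<close>
type_synonym ('v, 'a) mpoly = "('v \<Rightarrow>\<^sub>0 nat) \<Rightarrow>\<^sub>0 'a"

definition mvar :: "'v \<Rightarrow> ('v, 'a :: zero_neq_one) mpoly" where
  "mvar v = Poly_Mapping.single (Poly_Mapping.single v 1) 1"

text \<open>
  Frobenius companion matrix of \<open>t ^ k - a\<close>, for positive \<open>k\<close>. For \<open>k = 1\<close> the top-right entry is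
  the only entry and the subdiagonal is empty.
\<close>
definition frobenius_companion :: "nat \<Rightarrow> 'a :: zero_neq_one \<Rightarrow> 'a mat" where
  "frobenius_companion k a =
     mat k k (\<lambda>(i, j). if i = j + 1 then 1 else if i = 0 \<and> j = k - 1 then a else 0)"

text \<open>Rows and columns of the Kronecker product are numbered in the order of the usual block matrix
  whose blocks are \<open>(A $$ (i, j)) \<cdot>\<^sub>m B\<close>.\<close>
definition kronecker_product :: "'a :: semiring_0 mat \<Rightarrow> 'a mat \<Rightarrow> 'a mat" where
  "kronecker_product A B =
     mat (dim_row A * dim_row B) (dim_col A * dim_col B)
       (\<lambda>(i, j). A $$ (i div dim_row B, j div dim_col B) * B $$ (i mod dim_row B, j mod dim_col B))"

definition kronecker_sum :: "'a :: semiring_1 mat \<Rightarrow> 'a mat \<Rightarrow> 'a mat" where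
  "kronecker_sum A B =
     kronecker_product A (1\<^sub>m (dim_row B)) + kronecker_product (1\<^sub>m (dim_row A)) B"

text \<open>Iterated Kronecker sum. The empty sum is the neutral element, the zero matrix of order 1.\<close>
fun kronecker_sum_list :: "'a :: semiring_1 mat list \<Rightarrow> 'a mat" where
  "kronecker_sum_list [] = 0\<^sub>m 1 1"
| "kronecker_sum_list [A] = A"
| "kronecker_sum_list (A # B # As) = kronecker_sum A (kronecker_sum_list (B # As))"

definition char_exponent :: "'a :: field itself \<Rightarrow> nat" where
  "char_exponent _ = (if CHAR('a) = 0 then 1 else CHAR('a))"

text \<open>
  The polynomial \<open>q\<close>, as a polynomial in \<open>z\<close> over the polynomial ring in the variables \<open>x\<^sub>v\<close>.
  The elements of \<open>'v\<close> in increasing order play the role of the indices \<open>1, \<dots>, m\<close>.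
\<close>
definition q_poly :: "('v :: {finite, linorder} \<Rightarrow> nat) \<Rightarrow> ('v, 'a :: field) mpoly poly" where
  "q_poly n = char_poly (kronecker_sum_list
     (map (\<lambda>v. frobenius_companion (n v) (mvar v)) (sorted_list_of_set UNIV)))"

end

theory Submission
  imports "HOL-Algebra.Algebraic_Closure_Type" Defs
begin

text \<open>
  Let \<open>K\<close> be an algebraic closure of the ground field and embed \<open>k[x]\<close> into \<open>K[y]\<close> by
  \<open>x\<^sub>v \<mapsto> y\<^sub>v ^ n v\<close>. The image of \<open>q\<close> has the root \<open>\<Sum>v. y\<^sub>v\<close>, because \<open>y\<^sub>v\<close> is an
  eigenvalue of the companion matrix and eigenvalues add up under Kronecker sums. Suppose
  \<open>q = f * g\<close>, where \<open>f\<close> is the factor that vanishes at this root. The automorphisms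
  \<open>y\<^sub>v \<mapsto> \<zeta>\<^sub>v * y\<^sub>v\<close> of \<open>K[y]\<close>, with \<open>\<zeta>\<^sub>v ^ n v = 1\<close>, fix the image of \<open>k[x]\<close>, so \<open>f\<close> vanishes at
  all \<open>\<Sum>v. \<zeta>\<^sub>v * y\<^sub>v\<close>. By the assumption on the characteristic these are \<open>\<Prod>v. n v = degree q\<close>
  distinct elements. Hence \<open>g\<close> is constant, and it is a unit because \<open>q\<close> is monic.
\<close>

hide_const (open) Polynomials.degree Polynomials.lead_coeff up_ring.monom up_ring.coeff
  Divisibility.irreducible

subsection \<open>Roots of unity\<close>

text \<open>The polynomial \<open>z ^ n - 1\<close> splits into linear factors, and they are
  distinct because its derivative \<open>n * z ^ (n - 1)\<close> vanishes at most at 0, which is not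
  a root.\<close>

lemma card_roots_of_unity_alg_closed:
  assumes "of_nat n \<noteq> (0 :: 'a :: alg_closed_field)"
  shows "card {z :: 'a. z ^ n = 1} = n"
proof -
  define p :: "'a poly" where "p = monom 1 n - 1"
  have n: "n > 0"
    using assms by (cases n) auto
  have deg: "degree p = n"
    using degree_add_eq_left[of "- 1 :: 'a poly" "monom 1 n"] n by (simp add: p_def degree_monom_eq)
  have p0: "p \<noteq> 0"
    using deg n by auto
  obtain A where A: "size A = degree p" "p = smult (lead_coeff p) (\<Prod>x\<in>#A. [:-x, 1:])"
    using alg_closed_imp_factorization[OF p0] by blast
  have roots: "{z. z ^ n = 1} = set_mset A"
  proof -
    have "z ^ n = 1 \<longleftrightarrow> poly p z = 0" for z
      by (simp add: p_def poly_monom)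
    also have "poly p z = 0 \<longleftrightarrow> z \<in># A" for z
      using p0 by (subst A(2)) (auto simp: poly_prod_mset prod_mset_zero_iff)
    finally show ?thesis by blast
  qed
  \<comment> \<open>A root of multiplicity at least 2 is also a root of the derivative.\<close>
  have "count A x = 1" if x: "x \<in># A" for x
  proof (rule ccontr)
    assume "count A x \<noteq> 1"
    moreover obtain B where B: "A = add_mset x B"
      using x by (metis insert_DiffM)
    ultimately have "x \<in># B"
      by (simp add: not_in_iff)
    then obtain C where C: "A = add_mset x (add_mset x C)"
      using B by (metis insert_DiffM)
    define r where "r = smult (lead_coeff p) (\<Prod>x\<in>#C. [:-x, 1:])"
    have "p = [:-x, 1:] * ([:-x, 1:] * r)"
      unfolding r_def by (subst A(2)) (simp add: C)
    then have "poly (pderiv p) x = 0"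
      by (simp only: pderiv_mult) simp
    then have "of_nat n * x ^ (n - 1) = 0"
      by (simp add: p_def pderiv_monom pderiv_diff poly_monom)
    then have "x = 0"
      using assms by simp
    moreover have "x ^ n = 1"
      using roots x by blast
    ultimately show False
      using n by (simp add: zero_power)
  qed
  then have "card (set_mset A) = size A"
    by (simp add: size_multiset_overloaded_eq)
  then show ?thesis
    using A(1) deg roots by simp
qed

subsection \<open>Evaluation of polynomials\<close>

lemma poly_mapping_add_induct [case_names single add]:
  fixes p :: "'a \<Rightarrow>\<^sub>0 'b :: comm_monoid_add"
  assumes single: "\<And>k a. P (Poly_Mapping.single k a)"
    and add: "\<And>p q. P p \<Longrightarrow> P q \<Longrightarrow> P (p + q)"
  shows "P p"
proof (induction p rule: update_induct)
  case const
  \<comment> \<open>The zero polynomial is a single term with coefficient 0, at an arbitrary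
    key.\<close>
  show ?case using single[of undefined 0] by simp
next
  case (update f a b)
  have "Poly_Mapping.update a b f = f + Poly_Mapping.single a b"
    using update.hyps(1)
    by (intro poly_mapping_eqI) (auto simp: lookup_update lookup_add lookup_single in_keys_iff when_def)
  with update.IH single add show ?case by metis
qed

text \<open>The coefficient map \<open>h\<close> is a parameter because the embedding of
  \<open>k[x]\<close> into \<open>K[y]\<close> also enlarges the field.\<close>

definition mpoly_eval ::
    "('a \<Rightarrow> 'b) \<Rightarrow> ('v \<Rightarrow> 'b) \<Rightarrow> ('v :: finite, 'a :: comm_ring_1) mpoly \<Rightarrow> 'b :: comm_ring_1" where
  "mpoly_eval h c p =
     (\<Sum>k\<in>Poly_Mapping.keys p. h (Poly_Mapping.lookup p k) * (\<Prod>v\<in>UNIV. c v ^ Poly_Mapping.lookup k v))"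

lemma mpoly_eval_mvar:
  assumes "h 1 = 1"
  shows "mpoly_eval h c (mvar v) = c v"
proof -
  have "(\<Prod>w\<in>UNIV. c w ^ Poly_Mapping.lookup (Poly_Mapping.single v 1) w) =
        (\<Prod>w\<in>{v}. c w ^ Poly_Mapping.lookup (Poly_Mapping.single v 1) w)"
    by (intro prod.mono_neutral_right) (auto simp: lookup_single)
  then show ?thesis
    using assms by (simp add: mpoly_eval_def mvar_def)
qed

context comm_ring_hom
begin

lemma mpoly_eval_single:
  "mpoly_eval hom c (Poly_Mapping.single k a) = hom a * (\<Prod>v\<in>UNIV. c v ^ Poly_Mapping.lookup k v)"
  by (simp add: mpoly_eval_def)

lemma mpoly_eval_add: "mpoly_eval hom c (p + q) = mpoly_eval hom c p + mpoly_eval hom c q"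
  unfolding mpoly_eval_def
  by (rule setsum_keys_plus_distrib) (simp_all add: hom_add distrib_right)

text \<open>Both sides of the product rule are additive in each factor, which leaves products of two
  monomials.\<close>

lemma comm_ring_hom_mpoly_eval: "comm_ring_hom (mpoly_eval hom c)"
proof
  show "mpoly_eval hom c 0 = 0"
    by (simp add: mpoly_eval_def)
  show "mpoly_eval hom c 1 = 1"
    by (simp add: mpoly_eval_def)
  show "mpoly_eval hom c (p + q) = mpoly_eval hom c p + mpoly_eval hom c q" for p q
    by (rule mpoly_eval_add)
  show "mpoly_eval hom c (p * q) = mpoly_eval hom c p * mpoly_eval hom c q" for p q
  proof (induction p rule: poly_mapping_add_induct)
    case (single k a)
    show ?case
    proof (induction q rule: poly_mapping_add_induct)
      case (single l b)
      show ?case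
        by (simp add: mult_single mpoly_eval_single hom_mult lookup_add power_add prod.distrib ac_simps)
    qed (simp add: distrib_left mpoly_eval_add)
  qed (simp add: distrib_right mpoly_eval_add)
qed

lemma hom_mpoly_eval:
  assumes "comm_ring_hom g"
  shows "hom (mpoly_eval g c p) = mpoly_eval (\<lambda>a. hom (g a)) (\<lambda>v. hom (c v)) p"
  by (simp add: mpoly_eval_def hom_sum hom_mult hom_prod hom_power)

end

lemma comm_ring_hom_const: "comm_ring_hom (Poly_Mapping.single 0 :: 'a \<Rightarrow> ('v, 'a :: comm_ring_1) mpoly)"
  by unfold_locales (simp_all add: single_add mult_single)

subsection \<open>Eigenvectors of Kronecker sums\<close>

text \<open>The eigenvector lies in the kernel of \<open>k * I - A\<close>, so this matrix is
  singular. The setting is a domain because the application is to matrices over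
  \<open>K[y]\<close>.\<close>

lemma poly_char_poly_eq_0:
  fixes A :: "'a :: idom mat"
  assumes A: "A \<in> carrier_mat n n" and v: "eigenvector A v k"
  shows "poly (char_poly A) k = 0"
proof -
  define M where "M = k \<cdot>\<^sub>m 1\<^sub>m n + - A"
  have M: "M \<in> carrier_mat n n"
    using A by (auto simp: M_def)
  have vn: "v \<in> carrier_vec n" "v \<noteq> 0\<^sub>v n" "A *\<^sub>v v = k \<cdot>\<^sub>v v"
    using v A by (auto simp: eigenvector_def)
  have "M *\<^sub>v v = (k \<cdot>\<^sub>m 1\<^sub>m n) *\<^sub>v v + (- A) *\<^sub>v v"
    unfolding M_def using A vn by (intro add_mult_distrib_mat_vec) auto
  also have "(k \<cdot>\<^sub>m 1\<^sub>m n) *\<^sub>v v = k \<cdot>\<^sub>v v"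
    using vn(1) by (intro eq_vecI) auto
  also have "(- A) *\<^sub>v v = - (A *\<^sub>v v)"
    using A vn(1) by (intro eq_vecI) auto
  also have "k \<cdot>\<^sub>v v + - (A *\<^sub>v v) = 0\<^sub>v n"
    using vn by (intro eq_vecI) auto
  finally have "det M = 0"
    using det_0_iff_vec_prod_zero[OF M] vn by blast
  moreover have "poly (char_poly A) k = det M"
    unfolding char_poly_def
    by (rule poly_det_cong[OF M]) (use A in \<open>auto simp: char_poly_matrix_def M_def\<close>)
  ultimately show ?thesis by simp
qed

lemma eigenvector_iff_sum:
  assumes "A \<in> carrier_mat n n"
  shows "eigenvector A v k \<longleftrightarrow> dim_vec v = n \<and> (\<exists>i<n. v $ i \<noteq> 0) \<and>
    (\<forall>i<n. (\<Sum>j<n. A $$ (i, j) * v $ j) = k * v $ i)"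
proof (cases "dim_vec v = n")
  case True
  have "v \<noteq> 0\<^sub>v n \<longleftrightarrow> (\<exists>i<n. v $ i \<noteq> 0)"
    using True by (auto simp: vec_eq_iff)
  moreover have "A *\<^sub>v v = k \<cdot>\<^sub>v v \<longleftrightarrow> (\<forall>i<n. (\<Sum>j<n. A $$ (i, j) * v $ j) = k * v $ i)"
    using True assms by (auto simp: vec_eq_iff scalar_prod_def atLeast0LessThan)
  moreover have "dim_row A = n" "v \<in> carrier_vec n"
    using True assms by auto
  ultimately show ?thesis
    unfolding eigenvector_def using True by metis
next
  case False
  then show ?thesis
    using assms by (auto simp: eigenvector_def)
qed

lemma frobenius_companion_carrier [simp]: "frobenius_companion k a \<in> carrier_mat k k"
  by (simp add: frobenius_companion_def)

lemma eigenvalue_frobenius_companion: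
  fixes a b :: "'a :: comm_ring_1"
  assumes "b ^ k = a" "k > 0"
  shows "eigenvalue (frobenius_companion k a) b"
  unfolding eigenvalue_def
proof
  \<comment> \<open>Row \<open>i + 1\<close> of the eigenvalue equation reads \<open>v\<^sub>i = b * v\<^sub>i\<^sub>+\<^sub>1\<close>, which determines \<open>v\<close> from its last entry 1.\<close>
  let ?v = "vec k (\<lambda>i. b ^ (k - 1 - i))"
  have "(\<Sum>j<k. frobenius_companion k a $$ (i, j) * ?v $ j) = b * ?v $ i" if i: "i < k" for i
  proof (cases i)
    \<comment> \<open>Row 0 closes the cycle: \<open>a * 1 = b * b ^ (k - 1)\<close>.\<close>
    case 0
    have "(\<Sum>j<k. frobenius_companion k a $$ (i, j) * ?v $ j) =
          (\<Sum>j<k. if j = k - 1 then a else 0)"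
      using 0 assms(2) by (intro sum.cong) (auto simp: frobenius_companion_def)
    then show ?thesis
      using 0 assms by (auto simp: power_Suc[symmetric] simp del: power_Suc)
  next
    case (Suc l)
    have "(\<Sum>j<k. frobenius_companion k a $$ (i, j) * ?v $ j) =
          (\<Sum>j<k. if j = l then b ^ (k - 1 - l) else 0)"
      using Suc i by (intro sum.cong) (auto simp: frobenius_companion_def)
    moreover have "k - 1 - l = Suc (k - 1 - i)"
      using Suc i by auto
    ultimately show ?thesis
      using Suc i by simp
  qed
  \<comment> \<open>The last entry is \<open>b ^ 0 = 1\<close>, also for
    \<open>b = 0\<close>.\<close>
  moreover have "?v $ (k - 1) \<noteq> 0"
    using assms(2) by simp
  ultimately show "eigenvector (frobenius_companion k a) ?v b"
    unfolding eigenvector_iff_sum[OF frobenius_companion_carrier]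
    using assms(2) by (intro conjI exI[of _ "k - 1"] allI impI) simp_all
qed

lemma kronecker_sum_carrier:
  assumes "A \<in> carrier_mat p p" "B \<in> carrier_mat q q"
  shows "kronecker_sum A B \<in> carrier_mat (p * q) (p * q)"
  using assms by (simp add: kronecker_sum_def kronecker_product_def)

text \<open>Division with remainder by \<open>q\<close> is a bijection from indices below
  \<open>p * q\<close> to pairs, matching the block numbering of
  \<open>kronecker_product\<close>.\<close>

lemma sum_div_mod:
  fixes f :: "nat \<Rightarrow> nat \<Rightarrow> 'a :: comm_monoid_add"
  shows "(\<Sum>j<p * q. f (j div q) (j mod q)) = (\<Sum>a<p. \<Sum>b<q. f a b)"
proof (cases "q = 0")
  case False
  have *: "a * q + b < p * q" if "a < p" "b < q" for a b
  proof -
    have "a * q + b < Suc a * q" using that by simp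
    also have "\<dots> \<le> p * q" using that by (intro mult_le_mono1) simp
    finally show ?thesis .
  qed
  show ?thesis
    unfolding sum.cartesian_product
    by (rule sum.reindex_bij_witness[of _ "\<lambda>(a, b). a * q + b" "\<lambda>j. (j div q, j mod q)"])
      (use False in \<open>auto simp: less_mult_imp_div_less *\<close>)
qed simp

text \<open>If \<open>u\<close> and \<open>v\<close> are eigenvectors of \<open>A\<close> and
  \<open>B\<close>, their tensor product \<open>w\<close> is one of the Kronecker sum: the first
  summand multiplies it by \<open>a\<close>, the second by \<open>b\<close>.\<close>

lemma eigenvalue_kronecker_sum:
  fixes A B :: "'a :: idom mat"
  assumes A: "A \<in> carrier_mat p p" and B: "B \<in> carrier_mat q q"
    and a: "eigenvalue A a" and b: "eigenvalue B b"
  shows "eigenvalue (kronecker_sum A B) (a + b)"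
proof -
  obtain u v where "eigenvector A u a" "eigenvector B v b"
    using a b by (auto simp: eigenvalue_def)
  then obtain i j where u: "i < p" "u $ i \<noteq> 0" "\<And>i. i < p \<Longrightarrow> (\<Sum>j<p. A $$ (i, j) * u $ j) = a * u $ i"
    and v: "j < q" "v $ j \<noteq> 0" "\<And>i. i < q \<Longrightarrow> (\<Sum>j<q. B $$ (i, j) * v $ j) = b * v $ i"
    using eigenvector_iff_sum[OF A] eigenvector_iff_sum[OF B] by auto
  define w where "w = vec (p * q) (\<lambda>j. u $ (j div q) * v $ (j mod q))"
  have "(\<Sum>j<p * q. kronecker_sum A B $$ (i, j) * w $ j) = (a + b) * w $ i" if i: "i < p * q" for i
  proof -
    define c d where "c = i div q" and "d = i mod q"
    have q: "q > 0" using v(1) by simp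
    have cd: "c < p" "d < q"
      using i q by (auto simp: c_def d_def less_mult_imp_div_less)
    have "(\<Sum>j<p * q. kronecker_sum A B $$ (i, j) * w $ j) =
      (\<Sum>j<p * q. (\<lambda>e f. (A $$ (c, e) * (if d = f then 1 else 0) + (if c = e then 1 else 0) * B $$ (d, f)) *
        (u $ e * v $ f)) (j div q) (j mod q))"
      using A B i q
      by (intro sum.cong) (auto simp: kronecker_sum_def kronecker_product_def w_def c_def d_def less_mult_imp_div_less)
    also have "\<dots> = (\<Sum>e<p. \<Sum>f<q. (A $$ (c, e) * (if d = f then 1 else 0) +
        (if c = e then 1 else 0) * B $$ (d, f)) * (u $ e * v $ f))"
      by (rule sum_div_mod)
    \<comment> \<open>Each identity matrix acts as a Kronecker delta: the first collapses the sum
      over \<open>f\<close> to \<open>f = d\<close>, the second restricts \<open>e\<close> to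
      \<open>c\<close>.\<close>
    also have "\<dots> = (\<Sum>e<p. A $$ (c, e) * u $ e * v $ d +
        (if e = c then u $ e * (\<Sum>f<q. B $$ (d, f) * v $ f) else 0))"
    proof (intro sum.cong refl)
      fix e
      have "(\<Sum>f<q. (A $$ (c, e) * (if d = f then 1 else 0) +
          (if c = e then 1 else 0) * B $$ (d, f)) * (u $ e * v $ f)) =
        (\<Sum>f<q. (if f = d then A $$ (c, e) * u $ e * v $ d else 0) +
          (if e = c then u $ e * (B $$ (d, f) * v $ f) else 0))"
        by (intro sum.cong refl) (auto simp: algebra_simps)
      also have "\<dots> = A $$ (c, e) * u $ e * v $ d +
          (if e = c then u $ e * (\<Sum>f<q. B $$ (d, f) * v $ f) else 0)"
        using cd by (simp add: sum.distrib sum_distrib_left)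
      finally show "(\<Sum>f<q. (A $$ (c, e) * (if d = f then 1 else 0) +
          (if c = e then 1 else 0) * B $$ (d, f)) * (u $ e * v $ f)) = \<dots>" .
    qed
    also have "\<dots> = (\<Sum>e<p. A $$ (c, e) * u $ e) * v $ d + u $ c * (\<Sum>f<q. B $$ (d, f) * v $ f)"
      using cd by (simp add: sum.distrib sum_distrib_right)
    also have "\<dots> = (a + b) * w $ i"
      using u(3)[OF cd(1)] v(3)[OF cd(2)] i by (simp add: w_def c_def d_def algebra_simps)
    finally show ?thesis .
  qed
  \<comment> \<open>At this index \<open>w\<close> has the entry \<open>u $ i * v $ j\<close>, which
    is nonzero in a domain.\<close>
  moreover have "i * q + j < p * q"
  proof -
    have "i * q + j < Suc i * q" using v(1) by simp
    also have "\<dots> \<le> p * q" using u(1) by (intro mult_le_mono1) simp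
    finally show ?thesis .
  qed
  moreover from this have "w $ (i * q + j) \<noteq> 0"
    using u(2) v(1,2) by (simp add: w_def)
  ultimately have "eigenvector (kronecker_sum A B) w (a + b)"
    unfolding eigenvector_iff_sum[OF kronecker_sum_carrier[OF A B]] by (auto simp: w_def)
  then show ?thesis by (auto simp: eigenvalue_def)
qed

lemma kronecker_sum_list_carrier:
  assumes "list_all2 (\<lambda>A n. A \<in> carrier_mat n n) As ns"
  shows "kronecker_sum_list As \<in> carrier_mat (prod_list ns) (prod_list ns)"
  using assms
proof (induction As arbitrary: ns rule: kronecker_sum_list.induct)
  case (3 A B As)
  obtain m ms where ns: "ns = m # ms" "A \<in> carrier_mat m m"
      "list_all2 (\<lambda>A n. A \<in> carrier_mat n n) (B # As) ms"
    using "3.prems" by (auto simp: list_all2_Cons1)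
  show ?case
    using kronecker_sum_carrier[OF ns(2) "3.IH"[OF ns(3)]] by (simp add: ns(1))
qed (auto simp: list_all2_Cons1)

lemma eigenvalue_kronecker_sum_list:
  fixes As :: "'a :: idom mat list"
  assumes "list_all2 (\<lambda>A n. A \<in> carrier_mat n n) As ns" "list_all2 eigenvalue As bs" "As \<noteq> []"
  shows "eigenvalue (kronecker_sum_list As) (sum_list bs)"
  using assms
proof (induction As arbitrary: ns bs rule: kronecker_sum_list.induct)
  case (3 A B As)
  obtain m ms where ns: "ns = m # ms" "A \<in> carrier_mat m m"
      "list_all2 (\<lambda>A n. A \<in> carrier_mat n n) (B # As) ms"
    using "3.prems"(1) by (auto simp: list_all2_Cons1)
  obtain c cs where bs: "bs = c # cs" "eigenvalue A c" "list_all2 eigenvalue (B # As) cs"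
    using "3.prems"(2) by (auto simp: list_all2_Cons1)
  have "eigenvalue (kronecker_sum_list (B # As)) (sum_list cs)"
    using "3.IH"[OF ns(3) bs(3)] by simp
  from eigenvalue_kronecker_sum[OF ns(2) kronecker_sum_list_carrier[OF ns(3)] bs(2) this]
  show ?case by (simp add: bs(1))
qed (auto simp: list_all2_Cons1)

section \<open>Kronecker sums under ring homomorphisms\<close>

context comm_ring_hom
begin

lemma mat_hom_frobenius_companion: "map_mat hom (frobenius_companion k a) = frobenius_companion k (hom a)"
  by (rule eq_matI) (auto simp: frobenius_companion_def)

lemma mat_hom_kronecker_sum:
  assumes "A \<in> carrier_mat p p" "B \<in> carrier_mat q q"
  shows "map_mat hom (kronecker_sum A B) = kronecker_sum (map_mat hom A) (map_mat hom B)"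
proof (rule eq_matI)
  fix i j assume "i < dim_row (kronecker_sum (map_mat hom A) (map_mat hom B))"
    and "j < dim_col (kronecker_sum (map_mat hom A) (map_mat hom B))"
  then have ij: "i < p * q" "j < p * q"
    using assms by (auto simp: kronecker_sum_def kronecker_product_def)
  then have "q > 0"
    by (cases "q = 0") auto
  then show "map_mat hom (kronecker_sum A B) $$ (i, j) =
      kronecker_sum (map_mat hom A) (map_mat hom B) $$ (i, j)"
    using ij assms
    by (simp add: kronecker_sum_def kronecker_product_def less_mult_imp_div_less hom_add hom_mult)
qed (use assms in \<open>auto simp: kronecker_sum_def kronecker_product_def\<close>)

lemma mat_hom_kronecker_sum_list:
  assumes "list_all2 (\<lambda>A n. A \<in> carrier_mat n n) As ns"
  shows "map_mat hom (kronecker_sum_list As) = kronecker_sum_list (map (map_mat hom) As)"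
  using assms
proof (induction As arbitrary: ns rule: kronecker_sum_list.induct)
  case 1
  show ?case by (rule eq_matI) auto
next
  case (3 A B As)
  obtain m ms where ns: "ns = m # ms" "A \<in> carrier_mat m m"
      "list_all2 (\<lambda>A n. A \<in> carrier_mat n n) (B # As) ms"
    using "3.prems" by (auto simp: list_all2_Cons1)
  then show ?case
    using "3.IH"[OF ns(3)] mat_hom_kronecker_sum[OF ns(2) kronecker_sum_list_carrier[OF ns(3)]]
    by simp
qed simp

end

subsection \<open>Roots of the characteristic polynomial\<close>

lemma companion_list_carrier:
  "list_all2 (\<lambda>A n. A \<in> carrier_mat n n) (map (\<lambda>v. frobenius_companion (n v) (a v)) vs) (map n vs)"
  by (induction vs) auto

lemma prod_list_sorted_list_of_UNIV:
  "prod_list (map n (sorted_list_of_set UNIV)) = (\<Prod>v\<in>UNIV. n (v :: 'v :: {finite, linorder}))"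
  using prod.distinct_set_conv_list[of "sorted_list_of_set (UNIV :: 'v set)" n] by simp

lemma
  shows degree_q_poly: "degree (q_poly n :: ('v :: {finite, linorder}, 'k :: field) mpoly poly) = (\<Prod>v\<in>UNIV. n v)"
    and lead_coeff_q_poly: "lead_coeff (q_poly n :: ('v, 'k) mpoly poly) = 1"
proof -
  have "degree (q_poly n :: ('v, 'k) mpoly poly) = (\<Prod>v\<in>UNIV. n v) \<and>
        coeff (q_poly n :: ('v, 'k) mpoly poly) (\<Prod>v\<in>UNIV. n v) = 1"
    unfolding q_poly_def prod_list_sorted_list_of_UNIV[symmetric]
    by (intro degree_monic_char_poly kronecker_sum_list_carrier companion_list_carrier)
  then show "degree (q_poly n :: ('v, 'k) mpoly poly) = (\<Prod>v\<in>UNIV. n v)"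
    and "lead_coeff (q_poly n :: ('v, 'k) mpoly poly) = 1"
    by simp_all
qed

text \<open>Applying \<open>\<phi>\<close> to the matrix entries gives companion matrices of
  \<open>t ^ n v - y v ^ n v\<close>, which have the eigenvalues \<open>y v\<close>.\<close>

lemma q_poly_root:
  fixes \<phi> :: "('v :: {finite, linorder}, 'k :: field) mpoly \<Rightarrow> 'b :: idom"
  assumes "comm_ring_hom \<phi>" and y: "\<And>v. \<phi> (mvar v) = y v ^ n v" and n: "\<And>v. n v > 0"
  shows "poly (map_poly \<phi> (q_poly n)) (\<Sum>v\<in>UNIV. y v) = 0"
proof -
  interpret \<phi>: comm_ring_hom \<phi> by fact
  define vs where "vs = sorted_list_of_set (UNIV :: 'v set)"
  define As where "As = map (\<lambda>v. frobenius_companion (n v) (mvar v :: ('v, 'k) mpoly)) vs"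
  define Bs where "Bs = map (\<lambda>v. frobenius_companion (n v) (y v ^ n v)) vs"
  have As: "list_all2 (\<lambda>A n. A \<in> carrier_mat n n) As (map n vs)"
    and Bs: "list_all2 (\<lambda>A n. A \<in> carrier_mat n n) Bs (map n vs)"
    unfolding As_def Bs_def by (rule companion_list_carrier)+
  have "map (map_mat \<phi>) As = Bs"
    by (simp add: As_def Bs_def \<phi>.mat_hom_frobenius_companion y)
  then have "map_poly \<phi> (q_poly n) = char_poly (kronecker_sum_list Bs)"
    using \<phi>.char_poly_hom[OF kronecker_sum_list_carrier[OF As]] \<phi>.mat_hom_kronecker_sum_list[OF As]
    by (simp add: q_poly_def As_def vs_def)
  moreover have "eigenvalue (kronecker_sum_list Bs) (sum_list (map y vs))"
  proof (rule eigenvalue_kronecker_sum_list[OF Bs])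
    show "list_all2 eigenvalue Bs (map y vs)"
      by (auto simp: Bs_def list_all2_conv_all_nth n intro!: eigenvalue_frobenius_companion)
    show "Bs \<noteq> []"
      by (simp add: Bs_def vs_def)
  qed
  moreover have "sum_list (map y vs) = (\<Sum>v\<in>UNIV. y v)"
    using sum.distinct_set_conv_list[of vs y] by (simp add: vs_def)
  ultimately show ?thesis
    using poly_char_poly_eq_0[OF kronecker_sum_list_carrier[OF Bs]]
    by (auto simp: eigenvalue_def)
qed

section \<open>Rescaling of the variables\<close>

definition scale_vars :: "('v \<Rightarrow> 'a) \<Rightarrow> ('v :: finite, 'a :: comm_ring_1) mpoly \<Rightarrow> ('v, 'a) mpoly" where
  "scale_vars \<zeta> = mpoly_eval (Poly_Mapping.single 0) (\<lambda>v. Poly_Mapping.single 0 (\<zeta> v) * mvar v)"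

lemma comm_ring_hom_scale_vars: "comm_ring_hom (scale_vars \<zeta>)"
  unfolding scale_vars_def by (rule comm_ring_hom.comm_ring_hom_mpoly_eval[OF comm_ring_hom_const])

lemma scale_vars_mvar: "scale_vars \<zeta> (mvar v) = Poly_Mapping.single 0 (\<zeta> v) * mvar v"
  by (simp add: scale_vars_def mpoly_eval_mvar)

lemma scale_vars_const: "scale_vars \<zeta> (Poly_Mapping.single 0 a) = Poly_Mapping.single 0 a"
  by (simp add: scale_vars_def comm_ring_hom.mpoly_eval_single[OF comm_ring_hom_const])

text \<open>The coefficients of the linear form recover \<open>\<zeta>\<close>, so distinct families
  give distinct roots.\<close>

lemma lookup_scaled_sum_mvar:
  fixes \<zeta> :: "'v :: finite \<Rightarrow> 'a :: comm_ring_1"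
  shows "Poly_Mapping.lookup (\<Sum>v\<in>UNIV. Poly_Mapping.single 0 (\<zeta> v) * mvar v)
           (Poly_Mapping.single w 1) = \<zeta> w"
proof -
  have "Poly_Mapping.single v (1 :: nat) = Poly_Mapping.single w 1 \<longleftrightarrow> v = w" for v w :: 'v
    by (metis lookup_single_eq lookup_single_not_eq zero_neq_one)
  then show ?thesis
    by (simp add: lookup_sum mvar_def mult_single lookup_single when_def)
qed

subsection \<open>Irreducibility\<close>

theorem theorem6:
  fixes n :: "'v :: {finite, linorder} \<Rightarrow> nat"
  assumes "\<And>v. n v > 0"
    and "gcd (Lcm (range n)) (char_exponent TYPE('k :: field)) = 1"
  shows "irreducible (q_poly n :: ('v, 'k) mpoly poly)"
proof -
  define N where "N = (\<Prod>v\<in>UNIV. n v)"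
  define q where "q = (q_poly n :: ('v, 'k) mpoly poly)"
  define \<phi> :: "('v, 'k) mpoly \<Rightarrow> ('v, 'k alg_closure) mpoly"
    where "\<phi> = mpoly_eval (\<lambda>a. Poly_Mapping.single 0 (to_ac a)) (\<lambda>v. mvar v ^ n v)"
  define s :: "('v, 'k alg_closure) mpoly" where "s = (\<Sum>v\<in>UNIV. mvar v)"
  define Z where "Z = (\<Pi>\<^sub>E v\<in>UNIV. {z :: 'k alg_closure. z ^ n v = 1})"
  have const_ac: "comm_ring_hom (\<lambda>a :: 'k. Poly_Mapping.single 0 (to_ac a) :: ('v, 'k alg_closure) mpoly)"
    by unfold_locales (simp_all add: single_add mult_single)
  interpret \<phi>: comm_ring_hom \<phi>
    unfolding \<phi>_def by (rule comm_ring_hom.comm_ring_hom_mpoly_eval[OF const_ac])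
  have \<phi>_mvar: "\<phi> (mvar v) = mvar v ^ n v" for v
    by (simp add: \<phi>_def mpoly_eval_mvar)
  have N: "N > 0"
    using assms(1) by (simp add: N_def)
  have deg_q: "degree q = N" and lead_q: "lead_coeff q = 1"
    unfolding q_def N_def by (rule degree_q_poly lead_coeff_q_poly)+
  have q_root: "poly (map_poly \<phi> q) s = 0"
    unfolding q_def s_def by (rule q_poly_root[OF \<phi>.comm_ring_hom_axioms \<phi>_mvar assms(1)])

  \<comment> \<open>A nonzero characteristic dividing \<open>n v\<close> would divide both the
    \<open>Lcm\<close> and the characteristic exponent, hence 1.\<close>
  have nz: "of_nat (n v) \<noteq> (0 :: 'k alg_closure)" for v
  proof
    assume "of_nat (n v) = (0 :: 'k alg_closure)"
    then have dvd: "CHAR('k) dvd n v"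
      by (simp add: of_nat_eq_0_iff_char_dvd)
    then have "CHAR('k) \<noteq> 0"
      using assms(1)[of v] by auto
    moreover have "n v dvd Lcm (range n)"
      by (rule dvd_Lcm) simp
    ultimately have "CHAR('k) = 1"
      using assms(2) dvd by (metis char_exponent_def dvd_trans gcd_greatest dvd_refl nat_dvd_1_iff_1)
    then show False
      by (metis of_nat_CHAR of_nat_1 zero_neq_one)
  qed
  have card_Z: "card Z = N"
    by (simp add: Z_def N_def card_PiE card_roots_of_unity_alg_closed nz)

  have fix_\<phi>: "scale_vars \<zeta> (\<phi> p) = \<phi> p" if "\<zeta> \<in> Z" for \<zeta> p
  proof -
    interpret \<sigma>: comm_ring_hom "scale_vars \<zeta>" by (rule comm_ring_hom_scale_vars)
    have "Poly_Mapping.single 0 (\<zeta> v) ^ k = (Poly_Mapping.single 0 (\<zeta> v ^ k) :: ('v, 'k alg_closure) mpoly)" for v k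
      by (induction k) (simp_all add: mult_single)
    moreover have "\<zeta> v ^ n v = 1" for v
      using that by (auto simp: Z_def)
    ultimately have "scale_vars \<zeta> (mvar v ^ n v) = mvar v ^ n v" for v
      by (simp add: \<sigma>.hom_power scale_vars_mvar power_mult_distrib)
    then show ?thesis
      \<comment> \<open>Composing with \<open>scale_vars \<zeta>\<close> gives an evaluation with
        the same coefficient map and the same values at the variables, hence \<open>\<phi>\<close>
        again.\<close>
      unfolding \<phi>_def by (simp add: \<sigma>.hom_mpoly_eval[OF const_ac] scale_vars_const)
  qed

  have unit: "g dvd 1" if fg: "q = f * g" and root: "poly (map_poly \<phi> f) s = 0" for f g
  proof -
    have lead: "lead_coeff f * lead_coeff g = 1"
      using lead_q fg by (simp add: lead_coeff_mult)
    \<comment> \<open>The leading coefficient of \<open>f\<close> is a unit and so is its image,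
      hence \<open>f\<close> is not mapped to 0 and has finitely many roots.\<close>
    then have "\<phi> (lead_coeff f) * \<phi> (lead_coeff g) = 1"
      by (metis \<phi>.hom_mult \<phi>.hom_one)
    then have "coeff (map_poly \<phi> f) (degree f) \<noteq> 0"
      by (metis \<phi>.hom_zero coeff_map_poly mult_zero_left zero_neq_one)
    then have f'0: "map_poly \<phi> f \<noteq> 0"
      by (metis coeff_0)
    define r where "r \<zeta> = (\<Sum>v\<in>UNIV. Poly_Mapping.single 0 (\<zeta> v) * mvar v :: ('v, 'k alg_closure) mpoly)" for \<zeta>
    have "inj r"
    proof (intro injI ext)
      fix \<zeta> \<xi> v assume "r \<zeta> = r \<xi>"
      then show "\<zeta> v = \<xi> v"
        using lookup_scaled_sum_mvar[of \<zeta> v] lookup_scaled_sum_mvar[of \<xi> v] by (simp only: r_def)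
    qed
    have "poly (map_poly \<phi> f) (r \<zeta>) = 0" if "\<zeta> \<in> Z" for \<zeta>
    proof -
      interpret \<sigma>: comm_ring_hom "scale_vars \<zeta>" by (rule comm_ring_hom_scale_vars)
      have r: "r \<zeta> = scale_vars \<zeta> s"
        by (simp add: r_def s_def \<sigma>.hom_sum scale_vars_mvar)
      \<comment> \<open>The coefficients lie in the image of \<open>\<phi>\<close>, so applying
        \<open>scale_vars \<zeta>\<close> to the equation for \<open>s\<close> moves only the
        root.\<close>
      have f: "map_poly (scale_vars \<zeta>) (map_poly \<phi> f) = map_poly \<phi> f"
        by (rule poly_eqI) (simp add: coeff_map_poly fix_\<phi>[OF that])
      show ?thesis
        using \<sigma>.poly_map_poly[of "map_poly \<phi> f" s] by (simp add: r f root)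
    qed
    then have "r ` Z \<subseteq> {x. poly (map_poly \<phi> f) x = 0}"
      by auto
    then have "card (r ` Z) \<le> card {x. poly (map_poly \<phi> f) x = 0}"
      by (intro card_mono poly_roots_finite f'0)
    also have "\<dots> \<le> degree (map_poly \<phi> f)"
      by (rule card_poly_roots_bound[OF f'0])
    also have "\<dots> \<le> degree f"
      by (rule degree_map_poly_le)
    finally have "N \<le> degree f"
      using card_image[OF inj_on_subset[OF \<open>inj r\<close> subset_UNIV], of Z] card_Z by simp
    moreover have "degree f + degree g = N"
      using deg_q fg lead by (metis degree_mult_eq leading_coeff_0_iff mult_zero_left mult_zero_right zero_neq_one)
    ultimately have "degree g = 0" by simp
    \<comment> \<open>The constant \<open>c\<close> is the leading coefficient of \<open>g\<close>,
      a divisor of 1.\<close>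
    then obtain c where c: "g = [:c:]" by (rule degree_eq_zeroE)
    with lead have "c dvd 1"
      by (metis dvd_triv_right lead_coeff_pCons(2))
    then show ?thesis
      by (simp add: c is_unit_const_poly_iff)
  qed
  show "irreducible q"
  proof (rule irreducibleI)
    show "q \<noteq> 0"
      using lead_q by auto
    show "\<not> q dvd 1"
      using N deg_q by (auto simp: poly_dvd_1)
    show "f dvd 1 \<or> g dvd 1" if "q = f * g" for f g
    proof -
      interpret map_poly_comm_ring_hom \<phi> ..
      \<comment> \<open>In a domain one of the two factors vanishes at \<open>s\<close>, and then
        \<open>unit\<close> makes the other one a unit.\<close>
      have "poly (map_poly \<phi> f) s * poly (map_poly \<phi> g) s = 0"
        using q_root that by (simp add: hom_mult)
      then show ?thesis
        using unit[of f g] unit[of g f] that by (auto simp: mult.commute)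
    qed
  qed
qed

end
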